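(* Let $q\ge 3$ be an odd integer. For every positive integer $n$, the number $M_{\rm PB}(n,q)$ of polarity-balanced sequences of length $n$ over ${\cal A}_q$ satisfies $$M_{\rm PB}(n,q)=\sum_{j=0}^{\lfloor n/2\rfloor}\frac{n!}{j!\,j!\,(n-2j)!}\left(\frac{q-1}{2}\right)^{2j},$$ and, for fixed $q$, $$M_{\rm PB}(n,q)\approx q^n\sqrt{\frac{q}{2\pi n(q-1)}},$$ i.e. the ratio of the two sides tends to $1$ as $n\to\infty$.
   Context: For an integer $q\ge 2$, ${\cal A}_q=\{-q+1,-q+3,-q+5,\ldots,q-3,q-1\}$ (a set of $q$ integers, containing $0$ when $q$ is odd). A sequence ${\bf x}=(x_1,\ldots,x_n)\in({\cal A}_q)^n$ is polarity-balanced (PB) if $|\{i:x_i>0\}|=|\{i:x_i<0\}|$ (the number of zero symbols is unconstrained). $M_{\rm PB}(n,q)$ is the number of PB sequences in $({\cal A}_q)^n$. *)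

theory Defs
  imports Complex_Main
begin

definition alphabet :: "nat \<Rightarrow> int set" where
  "alphabet q = (\<lambda>k. - int q + 1 + 2 * int k) ` {..<q}"

definition polarity_balanced :: "int list \<Rightarrow> bool" where
  "polarity_balanced x \<longleftrightarrow>
     card {i. i < length x \<and> x ! i > 0} = card {i. i < length x \<and> x ! i < 0}"

definition M_PB :: "nat \<Rightarrow> nat \<Rightarrow> nat" where
  "M_PB n q = card {x. length x = n \<and> set x \<subseteq> alphabet q \<and> polarity_balanced x}"

end

theory Submission
  imports Defs "HOL-Probability.Probability" "HOL-Real_Asymp.Real_Asymp"
begin

text \<open>
  Write \<open>q = 2 m + 1\<close>. Counting by the positions of the positive and of the negative symbols gives the
  exact formula, and the sum is the constant term of \<open>(1 + m z + m / z)\<^sup>n\<close>, that is,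
  \<open>q\<^sup>n / (2 \<pi>)\<close> times the integral of \<open>\<phi>\<^sup>n\<close> over \<open>[-\<pi>, \<pi>]\<close> with \<open>\<phi> t = (1 + 2 m cos t) / (1 + 2 m)\<close>,
  the characteristic function of the sign of a random symbol. After the substitution
  \<open>t = s / sqrt n\<close> the integrand converges to \<open>exp (- m s\<^sup>2 / q)\<close> and is dominated by a Gaussian,
  because \<open>\<bar>\<phi> t\<bar> \<le> exp (- c t\<^sup>2)\<close> on \<open>[-\<pi>, \<pi>]\<close>.
\<close>

section \<open>Trigonometric and Gaussian preliminaries\<close>

lemma sin_ge_chord:
  fixes x :: real
  assumes "0 \<le> x" "x \<le> pi / 2"
  shows "2 * x / pi \<le> sin x"
proof -
  have "convex_on {0..pi/2} (\<lambda>x. - sin x)"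
    by (rule f''_ge0_imp_convex[where f' = "\<lambda>x. - cos x" and f'' = sin])
       (auto intro!: derivative_eq_intros sin_ge_zero)
  \<comment> \<open>The point \<open>x\<close> is the convex combination of 0 and
    \<open>pi / 2\<close> with weight \<open>2 * x / pi\<close> on the latter, so concavity of sine
    puts the chord below the graph.\<close>
  from convex_onD[OF this, of "2 * x / pi" 0 "pi / 2"] assms
  show ?thesis by (simp add: field_simps)
qed

text \<open>The half-angle formula turns the chord bound for sine into a quadratic bound on the
  whole period, sharp at 0 and at both endpoints. Being global, it spares a separate tail estimate
  for the integral.\<close>

lemma cos_le_quadratic:
  fixes t :: real
  assumes "\<bar>t\<bar> \<le> pi"
  shows "cos t \<le> 1 - 2 * t\<^sup>2 / pi\<^sup>2"
proof -
  have "cos t = 1 - 2 * (sin (\<bar>t\<bar> / 2))\<^sup>2"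
    using cos_double_sin[of "\<bar>t\<bar> / 2"] by simp
  moreover have "(\<bar>t\<bar> / pi)\<^sup>2 \<le> (sin (\<bar>t\<bar> / 2))\<^sup>2"
    using sin_ge_chord[of "\<bar>t\<bar> / 2"] assms by (intro power_mono) auto
  ultimately show ?thesis by (simp add: power_divide)
qed

lemma gaussian_integral:
  fixes c :: real
  assumes "c > 0"
  shows "integrable lborel (\<lambda>s. exp (- (c * s\<^sup>2)))"
    and "(\<integral>s. exp (- (c * s\<^sup>2)) \<partial>lborel) = sqrt (pi / c)"
proof -
  \<comment> \<open>The standard deviation for which the exponent of the centred normal density is
    \<open>- (c * s\<^sup>2)\<close>.\<close>
  define \<sigma> where "\<sigma> = sqrt (1 / (2 * c))"
  have \<sigma>: "\<sigma> > 0" "\<sigma>\<^sup>2 = 1 / (2 * c)" using assms by (auto simp: \<sigma>_def)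
  have eq: "(\<lambda>s. exp (- (c * s\<^sup>2))) = (\<lambda>s. sqrt (pi / c) * normal_density 0 \<sigma> s)"
    using assms by (auto simp: normal_density_def \<sigma> real_sqrt_divide field_simps)
  show "integrable lborel (\<lambda>s. exp (- (c * s\<^sup>2)))"
    unfolding eq using integrable_normal_density[OF \<sigma>(1)] by simp
  show "(\<integral>s. exp (- (c * s\<^sup>2)) \<partial>lborel) = sqrt (pi / c)"
    unfolding eq using integral_normal_density[OF \<sigma>(1)] by simp
qed

section \<open>The characteristic function: pointwise limit, domination, limit of integrals\<close>

definition trinomial_char :: "real \<Rightarrow> real \<Rightarrow> real" where
  "trinomial_char m t = (1 + 2 * m * cos t) / (1 + 2 * m)"

lemma trinomial_char_measurable [measurable]: "trinomial_char m \<in> borel_measurable borel"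
  unfolding trinomial_char_def by measurable

text \<open>The base is \<open>1 - u * (1 - cos x)\<close> with \<open>x = s / sqrt n\<close>. Since
  1 - cos x is asymptotically half the square of x, the power behaves like (1 - a/n)^n, where a is
  half of u times the square of s.\<close>

lemma trinomial_char_power_limit:
  assumes "m > 0"
  shows "(\<lambda>n. trinomial_char m (s / sqrt (real n)) ^ n)
           \<longlonglongrightarrow> exp (- (m / (1 + 2 * m) * s\<^sup>2))"
proof (cases "s = 0")
  case True
  then show ?thesis using assms by (simp add: trinomial_char_def)
next
  case False
  \<comment> \<open>Cosine is even, so \<open>s\<close> may be replaced by its absolute value; the
    asymptotic expansion then has a parameter of known sign.\<close>
  define r where "r = \<bar>s\<bar>"
  have r: "r > 0" "r\<^sup>2 = s\<^sup>2" using False by (auto simp: r_def)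
  define u where "u = 2 * m / (1 + 2 * m)"
  have "u > 0" using assms by (simp add: u_def)
  with r(1) have "(\<lambda>n. (1 - u * (1 - cos (r / sqrt (real n)))) ^ n) \<longlonglongrightarrow> exp (- (u * (r * r) / 2))"
    by real_asymp
  moreover have "1 - u * (1 - c) = (1 + 2 * m * c) / (1 + 2 * m)" for c
    using assms by (simp add: u_def field_simps)
  moreover have "u * (r * r) / 2 = m / (1 + 2 * m) * s\<^sup>2"
    using assms r(2) by (simp add: u_def power2_eq_square field_simps)
  moreover have "cos (r / sqrt (real n)) = cos (s / sqrt (real n))" for n
    by (auto simp: r_def abs_if)
  ultimately show ?thesis by (simp add: trinomial_char_def)
qed

lemma trinomial_char_gaussian_bound:
  assumes "m > 0"
  obtains c where "c > 0" "\<And>t. \<bar>t\<bar> \<le> pi \<Longrightarrow> \<bar>trinomial_char m t\<bar> \<le> exp (- (c * t\<^sup>2))"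
proof
  \<comment> \<open>The entry \<open>4 * m\<close> of the minimum serves the bound from above, where
    the quadratic estimate of cosine applies. The entry 2 serves the bound from below, where
    \<open>trinomial_char m t\<close> stays at least \<open>2 / (1 + 2 * m)\<close> above
    -1.\<close>
  define c where "c = min (4 * m) 2 / ((1 + 2 * m) * pi\<^sup>2)"
  show "c > 0" using assms by (simp add: c_def)
  fix t :: real assume t: "\<bar>t\<bar> \<le> pi"
  have t2: "t\<^sup>2 \<le> pi\<^sup>2" using t by (metis abs_ge_zero power2_abs power_mono)
  have "c * t\<^sup>2 \<le> 4 * m / ((1 + 2 * m) * pi\<^sup>2) * t\<^sup>2"
    unfolding c_def using assms by (intro mult_right_mono divide_right_mono) auto
  also have "\<dots> = 2 * m * (2 * t\<^sup>2 / pi\<^sup>2) / (1 + 2 * m)" by (simp add: mult_ac)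
  also have "\<dots> \<le> 2 * m * (1 - cos t) / (1 + 2 * m)"
    using cos_le_quadratic[OF t] assms
    by (intro divide_right_mono mult_left_mono) auto
  also have "\<dots> = 1 - trinomial_char m t"
    using assms by (simp add: trinomial_char_def field_simps)
  finally have upper: "trinomial_char m t \<le> 1 - c * t\<^sup>2" by simp
  have "c * t\<^sup>2 \<le> 2 / ((1 + 2 * m) * pi\<^sup>2) * pi\<^sup>2"
    unfolding c_def using assms t2 by (intro mult_mono divide_right_mono) auto
  also have "\<dots> = 2 / (1 + 2 * m)" by simp
  also have "\<dots> = 1 - (2 * m - 1) / (1 + 2 * m)" using assms by (simp add: field_simps)
  also have "\<dots> \<le> 1 + trinomial_char m t"
  proof -
    have "m * (- 1) \<le> m * cos t" using assms by (intro mult_left_mono) auto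
    then have "- ((2 * m - 1) / (1 + 2 * m)) \<le> (1 + 2 * m * cos t) / (1 + 2 * m)"
      unfolding minus_divide_left using assms by (intro divide_right_mono) auto
    then show ?thesis using assms by (simp add: trinomial_char_def)
  qed
  finally have "\<bar>trinomial_char m t\<bar> \<le> 1 + - (c * t\<^sup>2)" using upper by auto
  also have "\<dots> \<le> exp (- (c * t\<^sup>2))" by (rule exp_ge_add_one_self)
  finally show "\<bar>trinomial_char m t\<bar> \<le> exp (- (c * t\<^sup>2))" .
qed

lemma trinomial_char_integral_limit:
  assumes "m > 0"
  shows "(\<lambda>n. sqrt (real n) * (\<integral>t. trinomial_char m t ^ n * indicator {-pi..pi} t \<partial>lborel))
           \<longlonglongrightarrow> sqrt (pi * (1 + 2 * m) / m)"
proof -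
  let ?f = "\<lambda>n s. trinomial_char m (s / sqrt (real n)) ^ n * indicator {-pi..pi} (s / sqrt (real n))"
  obtain c where c: "c > 0" "\<And>t. \<bar>t\<bar> \<le> pi \<Longrightarrow> \<bar>trinomial_char m t\<bar> \<le> exp (- (c * t\<^sup>2))"
    using trinomial_char_gaussian_bound[OF assms] by blast
  have bound: "\<bar>?f n s\<bar> \<le> exp (- (c * s\<^sup>2))" if "n > 0" for n s
  proof (cases "\<bar>s / sqrt (real n)\<bar> \<le> pi")
    case True
    have "\<bar>?f n s\<bar> \<le> \<bar>trinomial_char m (s / sqrt (real n))\<bar> ^ n"
      by (simp add: power_abs indicator_def)
    also have "\<dots> \<le> exp (- (c * (s / sqrt (real n))\<^sup>2)) ^ n"
      by (intro power_mono c(2) True) auto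
    also have "\<dots> = exp (- (c * s\<^sup>2))"
      using that by (simp add: exp_of_nat_mult[symmetric] power_divide)
    finally show ?thesis .
  next
    case False
    then have "s / sqrt (real n) \<notin> {-pi..pi}" by auto
    then show ?thesis by simp
  qed
  have lim: "(\<lambda>n. ?f n s) \<longlonglongrightarrow> exp (- (m / (1 + 2 * m) * s\<^sup>2))" for s
  proof -
    \<comment> \<open>For fixed \<open>s\<close> the rescaled point eventually lies inside the
      interval, so the indicator does not affect the limit.\<close>
    have "(\<lambda>n. s / sqrt (real n)) \<longlonglongrightarrow> 0" by real_asymp
    then have "\<forall>\<^sub>F n in sequentially. - pi < s / sqrt (real n)"
      and "\<forall>\<^sub>F n in sequentially. s / sqrt (real n) < pi"
      by (rule order_tendstoD, simp)+
    then have "\<forall>\<^sub>F n in sequentially. trinomial_char m (s / sqrt (real n)) ^ n = ?f n s"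
      by eventually_elim (auto simp: indicator_def)
    then show ?thesis
      by (rule Lim_transform_eventually[OF trinomial_char_power_limit[OF assms]])
  qed
  \<comment> \<open>The index is shifted because domination fails at n = 0: division by zero gives
    0, so \<open>?f 0\<close> is constantly 1.\<close>
  have "(\<lambda>n. \<integral>s. ?f (Suc n) s \<partial>lborel) \<longlonglongrightarrow> (\<integral>s. exp (- (m / (1 + 2 * m) * s\<^sup>2)) \<partial>lborel)"
  proof (rule integral_dominated_convergence)
    show "integrable lborel (\<lambda>s. exp (- (c * s\<^sup>2)))" by (rule gaussian_integral[OF c(1)])
    show "AE s in lborel. (\<lambda>n. ?f (Suc n) s) \<longlonglongrightarrow> exp (- (m / (1 + 2 * m) * s\<^sup>2))"
      by (intro AE_I2 LIMSEQ_Suc lim)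
    show "AE s in lborel. norm (?f (Suc n) s) \<le> exp (- (c * s\<^sup>2))" for n
      using bound[of "Suc n"] by (auto intro!: AE_I2)
  qed measurable
  then have "(\<lambda>n. \<integral>s. ?f n s \<partial>lborel) \<longlonglongrightarrow> (\<integral>s. exp (- (m / (1 + 2 * m) * s\<^sup>2)) \<partial>lborel)"
    by (rule LIMSEQ_imp_Suc)
  also have "(\<integral>s. exp (- (m / (1 + 2 * m) * s\<^sup>2)) \<partial>lborel) = sqrt (pi * (1 + 2 * m) / m)"
    using gaussian_integral(2)[of "m / (1 + 2 * m)"] assms by simp
  finally have L: "(\<lambda>n. \<integral>s. ?f n s \<partial>lborel) \<longlonglongrightarrow> sqrt (pi * (1 + 2 * m) / m)" .
  have "\<forall>\<^sub>F n in sequentially. (\<integral>s. ?f n s \<partial>lborel) =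
     sqrt (real n) * (\<integral>t. trinomial_char m t ^ n * indicator {-pi..pi} t \<partial>lborel)"
    using eventually_gt_at_top[of 0]
  proof eventually_elim
    case (elim n)
    then show ?case
      \<comment> \<open>The substitution \<open>t = s / sqrt n\<close>; its Jacobian produces the
        factor \<open>sqrt n\<close>.\<close>
      using lborel_integral_real_affine[of "1 / sqrt (real n)"
          "\<lambda>t. trinomial_char m t ^ n * indicator {-pi..pi} t" 0]
      by (simp add: field_simps)
  qed
  then show ?thesis by (rule Lim_transform_eventually[OF L])
qed

section \<open>Cosine moments and the integral form of the sum\<close>

lemma integrable_cos_power:
  "integrable lborel (\<lambda>t :: real. cos t ^ k * indicator {-pi..pi} t)"
  using borel_integrable_compact[of "{-pi..pi}" "\<lambda>t :: real. cos t ^ k"]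
  by (simp add: continuous_intros mult.commute)

text \<open>The difference of the two integrands is the derivative of
  \<open>sin t * cos t ^ Suc k\<close>, which vanishes at both endpoints because sine does.\<close>

lemma integral_cos_power_step:
  "(real k + 2) * (\<integral>t. cos t ^ (k + 2) * indicator {-pi..pi} t \<partial>lborel)
     = (real k + 1) * (\<integral>t. cos t ^ k * indicator {-pi..pi} t \<partial>lborel)"
proof -
  have "0 = (\<integral>t. ((real k + 2) * cos t ^ (k + 2) - (real k + 1) * cos t ^ k) * indicator {-pi..pi} t \<partial>lborel)"
  proof (subst integral_FTC_Icc_real[where F = "\<lambda>t. sin t * cos t ^ Suc k"])
    fix t :: real
    have "((\<lambda>t. sin t * cos t ^ Suc k) has_real_derivative
            cos t * cos t ^ Suc k + (1 + real k) * (- sin t * cos t ^ k) * sin t) (at t)"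
      by (intro DERIV_mult DERIV_sin DERIV_power_Suc DERIV_cos)
    also have "cos t * cos t ^ Suc k + (1 + real k) * (- sin t * cos t ^ k) * sin t
         = cos t * cos t ^ Suc k - (real k + 1) * (sin t)\<^sup>2 * cos t ^ k"
      by (simp add: power2_eq_square algebra_simps)
    also have "\<dots> = (real k + 2) * cos t ^ (k + 2) - (real k + 1) * cos t ^ k"
      unfolding sin_squared_eq by (simp add: power2_eq_square algebra_simps)
    finally show "((\<lambda>t. sin t * cos t ^ Suc k) has_real_derivative
            (real k + 2) * cos t ^ (k + 2) - (real k + 1) * cos t ^ k) (at t)" .
  qed (auto intro!: continuous_intros)
  also have "\<dots> = (\<integral>t. (real k + 2) * (cos t ^ (k + 2) * indicator {-pi..pi} t)
                  - (real k + 1) * (cos t ^ k * indicator {-pi..pi} t) \<partial>lborel)"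
    by (simp only: algebra_simps)
  also have "\<dots> = (real k + 2) * (\<integral>t. cos t ^ (k + 2) * indicator {-pi..pi} t \<partial>lborel)
                  - (real k + 1) * (\<integral>t. cos t ^ k * indicator {-pi..pi} t \<partial>lborel)"
    by (subst Bochner_Integration.integral_diff)
       (intro integrable_mult_right integrable_cos_power | simp only: integral_mult_right_zero)+
  finally show ?thesis by simp
qed

lemma integral_cos_power_even:
  "(\<integral>t. cos t ^ (2 * j) * indicator {-pi..pi} t \<partial>lborel) = 2 * pi * fact (2 * j) / (4 ^ j * fact j * fact j)"
proof (induction j)
  case (Suc j)
  define X where "X = (\<integral>t. cos t ^ (2 * Suc j) * indicator {-pi..pi} t \<partial>lborel)"
  have "(2 * real j + 2) * X = (2 * real j + 1) * (2 * pi * fact (2 * j) / (4 ^ j * fact j * fact j))"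
    using integral_cos_power_step[of "2 * j"] unfolding Suc.IH by (simp add: X_def)
  then have "X = (2 * real j + 1) * (2 * pi * fact (2 * j) / (4 ^ j * fact j * fact j)) / (2 * real j + 2)"
    by (subst eq_divide_eq) (simp add: mult.commute)
  also have "\<dots> = 2 * pi * fact (2 * Suc j) / (4 ^ Suc j * fact (Suc j) * fact (Suc j))"
    by (simp add: divide_simps) (simp add: algebra_simps)
  finally show ?case unfolding X_def .
qed simp

lemma integral_cos_power_odd:
  "(\<integral>t. cos t ^ (2 * j + 1) * indicator {-pi..pi} t \<partial>lborel) = 0"
proof (induction j)
  case 0
  show ?case
    using integral_FTC_Icc_real[of "-pi" pi sin cos] by (simp add: DERIV_sin)
next
  case (Suc j)
  have "2 * Suc j + 1 = 2 * j + 1 + 2" by simp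
  moreover have "real (2 * j + 1) + 2 \<noteq> 0" by linarith
  ultimately show ?case
    using integral_cos_power_step[of "2 * j + 1"] unfolding Suc.IH by (simp only: mult_zero_right mult_eq_0_iff simp_thms)
qed

lemma sum_even_support:
  fixes f :: "nat \<Rightarrow> 'a :: comm_monoid_add"
  assumes "\<And>j. f (2 * j + 1) = 0"
  shows "(\<Sum>k\<le>n. f k) = (\<Sum>j\<le>n div 2. f (2 * j))"
proof -
  have "(\<Sum>j\<le>n div 2. f (2 * j)) = (\<Sum>k\<in>(*) 2 ` {..n div 2}. f k)"
    by (simp add: sum.reindex inj_on_def)
  also have "\<dots> = (\<Sum>k\<le>n. f k)"
  proof (rule sum.mono_neutral_left)
    show "\<forall>k\<in>{..n} - (*) 2 ` {..n div 2}. f k = 0"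
    proof
      fix k assume k: "k \<in> {..n} - (*) 2 ` {..n div 2}"
      have "odd k"
      proof
        assume "even k"
        then obtain j where "k = 2 * j" by blast
        with k show False by auto
      qed
      then show "f k = 0" using assms by (auto elim!: oddE)
    qed
  qed auto
  finally show ?thesis by simp
qed

text \<open>Expand \<open>(1 + 2 * m * cos t) ^ n\<close> binomially and integrate termwise. Odd
  moments vanish; in the even ones \<open>4 ^ j\<close> cancels the power of 2 and
  \<open>fact (2 * j)\<close> cancels against the binomial coefficient, leaving the trinomial
  coefficient times \<open>2 * pi\<close>.\<close>

lemma central_trinomial_sum_eq_integral:
  assumes "m > 0"
  shows "(\<Sum>j = 0..n div 2. fact n / (fact j * fact j * fact (n - 2 * j)) * m ^ (2 * j))
     = (1 + 2 * m) ^ n / (2 * pi) * (\<integral>t. trinomial_char m t ^ n * indicator {-pi..pi} t \<partial>lborel)"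
proof -
  let ?C = "\<lambda>k. \<integral>t. cos t ^ k * indicator {-pi..pi} t \<partial>lborel"
  have "(1 + 2 * m) ^ n * (\<integral>t. trinomial_char m t ^ n * indicator {-pi..pi} t \<partial>lborel)
      = (\<integral>t. (2 * m * cos t + 1) ^ n * indicator {-pi..pi} t \<partial>lborel)"
    using assms by (simp add: trinomial_char_def power_divide add.commute)
  also have "\<dots> = (\<integral>t. (\<Sum>k\<le>n. real (n choose k) * (2 * m) ^ k * (cos t ^ k * indicator {-pi..pi} t)) \<partial>lborel)"
    unfolding binomial_ring sum_distrib_right by (simp add: power_mult_distrib mult_ac)
  also have "\<dots> = (\<Sum>k\<le>n. real (n choose k) * (2 * m) ^ k * ?C k)"
    by (subst Bochner_Integration.integral_sum) (auto intro!: integrable_mult_right integrable_cos_power)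
  also have "\<dots> = (\<Sum>j\<le>n div 2. real (n choose (2 * j)) * (2 * m) ^ (2 * j) * ?C (2 * j))"
    by (rule sum_even_support) (subst integral_cos_power_odd, simp)
  also have "\<dots> = (\<Sum>j\<le>n div 2. 2 * pi * (fact n / (fact j * fact j * fact (n - 2 * j)) * m ^ (2 * j)))"
  proof (intro sum.cong refl)
    fix j assume "j \<in> {..n div 2}"
    then have "2 * j \<le> n" by auto
    moreover have "(2 :: real) ^ (2 * j) = 4 ^ j" by (simp add: power_mult)
    ultimately show "real (n choose (2 * j)) * (2 * m) ^ (2 * j) * ?C (2 * j)
        = 2 * pi * (fact n / (fact j * fact j * fact (n - 2 * j)) * m ^ (2 * j))"
      unfolding integral_cos_power_even by (simp add: binomial_fact power_mult_distrib mult_ac)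
  qed
  also have "\<dots> = 2 * pi * (\<Sum>j = 0..n div 2. fact n / (fact j * fact j * fact (n - 2 * j)) * m ^ (2 * j))"
    by (simp only: sum_distrib_left atLeast0AtMost)
  finally have eq: "(1 + 2 * m) ^ n * (\<integral>t. trinomial_char m t ^ n * indicator {-pi..pi} t \<partial>lborel) = \<dots>" .
  have "S = X / (2 * pi) * I" if "X * I = 2 * pi * S" for S X I :: real
    by (simp add: that)
  from this[OF eq] show ?thesis .
qed

text \<open>The normalising factor is exactly \<open>(1 + 2 * m) ^ n / (2 * pi)\<close> times
  \<open>?L / sqrt n\<close>, so the quotient is the scaled integral divided by its own limit
  \<open>?L\<close>.\<close>

lemma central_trinomial_sum_asymptotics:
  fixes m :: real
  assumes "m > 0"
  shows "(\<lambda>n. (\<Sum>j = 0..n div 2. fact n / (fact j * fact j * fact (n - 2 * j)) * m ^ (2 * j))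
            / ((1 + 2 * m) ^ n * sqrt ((1 + 2 * m) / (4 * pi * real n * m)))) \<longlonglongrightarrow> 1"
proof -
  let ?I = "\<lambda>n. \<integral>t. trinomial_char m t ^ n * indicator {-pi..pi} t \<partial>lborel"
  let ?L = "sqrt (pi * (1 + 2 * m) / m)"
  have "?L > 0" using assms by simp
  then have "(\<lambda>n. sqrt (real n) * ?I n / ?L) \<longlonglongrightarrow> ?L / ?L"
    by (intro tendsto_divide trinomial_char_integral_limit assms) (use assms in auto)
  also have "?L / ?L = 1" using \<open>?L > 0\<close> by (metis divide_self less_irrefl)
  finally have L: "(\<lambda>n. sqrt (real n) * ?I n / ?L) \<longlonglongrightarrow> 1" .
  have "sqrt (real n) * ?I n / ?L =
      (1 + 2 * m) ^ n / (2 * pi) * ?I n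
        / ((1 + 2 * m) ^ n * sqrt ((1 + 2 * m) / (4 * pi * real n * m)))" for n
  \<comment> \<open>At n = 0 both sides are 0 by the convention for division by zero.\<close>
  proof (cases "n = 0")
    case False
    have "sqrt ((1 + 2 * m) / (4 * pi * real n * m)) = sqrt ((?L / (2 * pi))\<^sup>2 / real n)"
      using assms False by (simp add: power_divide power2_eq_square field_simps)
    also have "\<dots> = ?L / (2 * pi) / sqrt (real n)"
      using assms by (simp add: real_sqrt_divide)
    finally show ?thesis using assms False by simp
  qed simp
  with L show ?thesis by (simp only: central_trinomial_sum_eq_integral[OF assms])
qed

section \<open>Counting words by the numbers of letters in two disjoint classes\<close>

lemma trinomial_weight_recurrence:
  fixes p s r :: nat
  shows "p * (if a = 0 then 0 else (n choose (a - 1)) * ((n - (a - 1)) choose b) * p ^ (a - 1) * s ^ b * r ^ (n - (a - 1) - b))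
      + s * (if b = 0 then 0 else (n choose a) * ((n - a) choose (b - 1)) * p ^ a * s ^ (b - 1) * r ^ (n - a - (b - 1)))
      + r * ((n choose a) * ((n - a) choose b) * p ^ a * s ^ b * r ^ (n - a - b))
   = (Suc n choose a) * ((Suc n - a) choose b) * p ^ a * s ^ b * r ^ (Suc n - a - b)"
\<comment> \<open>In this range the three summands share one monomial in \<open>p\<close>,
  \<open>s\<close>, \<open>r\<close>, and the claim reduces to the Pascal rule for trinomial
  coefficients.\<close>
proof (cases "a + b \<le> Suc n")
  case True
  let ?m = "\<lambda>n a b. (n choose a) * ((n - a) choose b)"
  have pascal: "(if a = 0 then 0 else ?m n (a - 1) b) + (if b = 0 then 0 else ?m n a (b - 1))
      + ?m n a b = ?m (Suc n) a b"
  proof (cases "a \<le> n")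
    case True
    then have "Suc n - a = Suc (n - a)" by simp
    then show ?thesis by (cases a; cases b) (auto simp: algebra_simps)
  next
    case False
    with \<open>a + b \<le> Suc n\<close> have "a = Suc n" "b = 0" by auto
    then show ?thesis by simp
  qed
  \<comment> \<open>When \<open>a + b = Suc n\<close> the truncated exponents do not match, but then
    the coefficient is zero.\<close>
  have "r * (?m n a b * p ^ a * s ^ b * r ^ (n - a - b)) = ?m n a b * p ^ a * s ^ b * r ^ (Suc n - a - b)"
  proof (cases "a + b \<le> n")
    case True
    then have "Suc n - a - b = Suc (n - a - b)" by simp
    then show ?thesis by simp
  qed auto
  moreover have "p * (if a = 0 then 0 else ?m n (a - 1) b * p ^ (a - 1) * s ^ b * r ^ (n - (a - 1) - b))
      = (if a = 0 then 0 else ?m n (a - 1) b) * p ^ a * s ^ b * r ^ (Suc n - a - b)"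
    by (cases a) auto
  moreover have "s * (if b = 0 then 0 else ?m n a (b - 1) * p ^ a * s ^ (b - 1) * r ^ (n - a - (b - 1)))
      = (if b = 0 then 0 else ?m n a (b - 1)) * p ^ a * s ^ b * r ^ (Suc n - a - b)"
    by (cases b) (auto simp: Suc_diff_le)
  ultimately show ?thesis
    unfolding pascal[symmetric] by (simp only: algebra_simps)
next
  case False
  \<comment> \<open>Outside the range every coefficient vanishes, since even
    \<open>a + b - 1\<close> exceeds \<open>n\<close>.\<close>
  have zero: "(n choose i) * ((n - i) choose j) = 0" if "i + j > n" for n i j :: nat
    using that by (auto simp: binomial_eq_0_iff)
  have "(Suc n choose a) * ((Suc n - a) choose b) = 0" "(n choose a) * ((n - a) choose b) = 0"
    by (rule zero, use False in simp)+
  moreover have "(n choose (a - 1)) * ((n - (a - 1)) choose b) = 0" if "a \<noteq> 0"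
    by (rule zero) (use False that in simp)
  moreover have "(n choose a) * ((n - a) choose (b - 1)) = 0" if "b \<noteq> 0"
    by (rule zero) (use False that in simp)
  ultimately show ?thesis
    by (cases "a = 0"; cases "b = 0")
       (simp_all only: if_True if_False mult_zero_left mult_zero_right add_0_left
          not_False_eq_True simp_thms)
qed

text \<open>Induction on the length, splitting on the class of the first letter; this lowers one of
  the two counts or neither, hence \<open>a\<close> and \<open>b\<close> are arbitrary.\<close>

lemma card_lists_two_counts:
  fixes A :: "'a set"
  assumes "finite A" and disj: "\<And>x. \<not> (P x \<and> Q x)"
  shows "card {x. length x = n \<and> set x \<subseteq> A \<and> length (filter P x) = a \<and> length (filter Q x) = b}
     = (n choose a) * ((n - a) choose b) * card {x\<in>A. P x} ^ a * card {x\<in>A. Q x} ^ b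
         * card {x\<in>A. \<not> P x \<and> \<not> Q x} ^ (n - a - b)"
proof (induction n arbitrary: a b)
  case 0
  have "{x :: 'a list. x = [] \<and> set x \<subseteq> A \<and> length (filter P x) = a \<and> length (filter Q x) = b}
      = (if a = 0 \<and> b = 0 then {[]} else {})" by auto
  then show ?case by (cases a; cases b) auto
next
  case (Suc n)
  let ?P = "{x\<in>A. P x}" and ?Q = "{x\<in>A. Q x}" and ?R = "{x\<in>A. \<not> P x \<and> \<not> Q x}"
  define S where
    "S n a b = {x. length x = n \<and> set x \<subseteq> A \<and> length (filter P x) = a \<and> length (filter Q x) = b}" for n a b
  define c where "c a b = (n choose a) * ((n - a) choose b) * card ?P ^ a * card ?Q ^ b
    * card ?R ^ (n - a - b)" for a b
  \<comment> \<open>The admissible tails after the first letter \<open>y\<close>. The empty cases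
    are essential: truncated subtraction would otherwise let a required count of 0 survive a letter
    of that class.\<close>
  define T where "T y = (if P y then (if a = 0 then {} else S n (a - 1) b)
    else if Q y then (if b = 0 then {} else S n a (b - 1)) else S n a b)" for y
  have card_S: "card (S n a b) = c a b" for a b unfolding S_def c_def by (rule Suc.IH)
  have "finite (S n a b)" for a b
    unfolding S_def by (rule finite_subset[OF _ finite_lists_length_eq[OF assms(1), of n]]) auto
  then have fin: "finite (T y)" for y by (simp add: T_def)
  have card_T: "card (T y) = (if P y then (if a = 0 then 0 else c (a - 1) b)
    else if Q y then (if b = 0 then 0 else c a (b - 1)) else c a b)" for y
    by (simp add: T_def card_S)
  have "S (Suc n) a b = (\<Union>y\<in>A. (#) y ` T y)"
  proof (intro set_eqI iffI)
    fix x assume x: "x \<in> S (Suc n) a b"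
    then obtain y z where yz: "x = y # z" by (cases x) (auto simp: S_def)
    have "z \<in> T y"
      using x disj[of y] unfolding yz by (cases "P y"; cases "Q y") (auto simp: S_def T_def)
    moreover have "y \<in> A" using x yz by (simp add: S_def)
    ultimately show "x \<in> (\<Union>y\<in>A. (#) y ` T y)" unfolding yz by blast
  next
    fix x assume "x \<in> (\<Union>y\<in>A. (#) y ` T y)"
    then obtain y z where yz: "x = y # z" "y \<in> A" "z \<in> T y" by blast
    then show "x \<in> S (Suc n) a b"
      using disj[of y] by (auto simp: S_def T_def split: if_splits)
  qed
  also have "card \<dots> = (\<Sum>y\<in>A. card ((#) y ` T y))"
    by (rule card_UN_disjoint) (use assms(1) fin in auto)
  also have "\<dots> = (\<Sum>y\<in>A. card (T y))" by (simp add: card_image)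
  also have "\<dots> = (\<Sum>y\<in>(?P \<union> ?Q) \<union> ?R. card (T y))"
    by (intro sum.cong refl) auto
  also have "\<dots> = (\<Sum>y\<in>?P \<union> ?Q. card (T y)) + (\<Sum>y\<in>?R. card (T y))"
    by (rule sum.union_disjoint) (use assms(1) in auto)
  also have "(\<Sum>y\<in>?P \<union> ?Q. card (T y)) = (\<Sum>y\<in>?P. card (T y)) + (\<Sum>y\<in>?Q. card (T y))"
    by (rule sum.union_disjoint) (use assms in auto)
  also have "(\<Sum>y\<in>?P. card (T y)) = card ?P * (if a = 0 then 0 else c (a - 1) b)"
    by (simp add: card_T)
  also have "(\<Sum>y\<in>?Q. card (T y)) = (\<Sum>y\<in>?Q. if b = 0 then 0 else c a (b - 1))"
    using disj by (intro sum.cong refl) (auto simp: card_T)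
  also have "\<dots> = card ?Q * (if b = 0 then 0 else c a (b - 1))" by simp
  also have "(\<Sum>y\<in>?R. card (T y)) = card ?R * c a b" by (simp add: card_T)
  finally show ?case
    unfolding S_def c_def trinomial_weight_recurrence .
qed

section \<open>The alphabet and the exact formula\<close>

lemma alphabet_sign_classes:
  "finite (alphabet (2 * m + 1))"
  "card {x \<in> alphabet (2 * m + 1). x > 0} = m"
  "card {x \<in> alphabet (2 * m + 1). x < 0} = m"
  "{x \<in> alphabet (2 * m + 1). \<not> x > 0 \<and> \<not> x < 0} = {0}"
proof -
  \<comment> \<open>Since \<open>- q + 1 + 2 * k = 2 * (k - m)\<close>, the alphabet consists of the
    doubles of a symmetric interval, and the signs are those of the interval.\<close>
  have eq: "alphabet (2 * m + 1) = (\<lambda>k. 2 * k) ` {- int m..int m}"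
  proof -
    have "{- int m..int m} = (\<lambda>k. int k - int m) ` {..<2 * m + 1}"
    proof (intro set_eqI iffI)
      fix x assume "x \<in> {- int m..int m}"
      then show "x \<in> (\<lambda>k. int k - int m) ` {..<2 * m + 1}"
        by (intro image_eqI[of _ _ "nat (x + int m)"]) auto
    qed auto
    then show ?thesis by (auto simp: alphabet_def image_image intro!: image_cong)
  qed
  show "finite (alphabet (2 * m + 1))" unfolding eq by simp
  have "{x \<in> alphabet (2 * m + 1). x > 0} = (\<lambda>k. 2 * k) ` {1..int m}" unfolding eq by auto
  then show "card {x \<in> alphabet (2 * m + 1). x > 0} = m" by (simp add: card_image inj_on_def)
  have "{x \<in> alphabet (2 * m + 1). x < 0} = (\<lambda>k. 2 * k) ` {- int m..-1}" unfolding eq by auto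
  then show "card {x \<in> alphabet (2 * m + 1). x < 0} = m" by (simp add: card_image inj_on_def)
  show "{x \<in> alphabet (2 * m + 1). \<not> x > 0 \<and> \<not> x < 0} = {0}" unfolding eq by auto
qed

text \<open>Split by the common number \<open>j\<close> of positive and negative symbols. Each of
  these classes has \<open>m\<close> elements and zero is the only other symbol, so the third factor
  of the count is a power of 1.\<close>

lemma M_PB_odd:
  "M_PB n (2 * m + 1) = (\<Sum>j = 0..n div 2. (n choose j) * ((n - j) choose j) * m ^ (2 * j))"
proof -
  let ?S = "\<lambda>j. {x. length x = n \<and> set x \<subseteq> alphabet (2 * m + 1) \<and>
    length (filter (\<lambda>y. y > 0) x) = j \<and> length (filter (\<lambda>y. y < 0) x) = j}"
  have fin: "finite (?S j)" for j
    by (rule finite_subset[OF _ finite_lists_length_eq[OF alphabet_sign_classes(1)[of m], of n]]) auto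
  \<comment> \<open>This forces \<open>2 * j \<le> n\<close>, which bounds the range of
    \<open>j\<close>.\<close>
  have le: "length (filter (\<lambda>y. y > 0) x) + length (filter (\<lambda>y. y < 0) x) \<le> length x"
    for x :: "int list"
    by (induction x) auto
  have "{x. length x = n \<and> set x \<subseteq> alphabet (2 * m + 1) \<and> polarity_balanced x} = (\<Union>j\<in>{0..n div 2}. ?S j)"
  proof (intro set_eqI iffI)
    fix x assume "x \<in> {x. length x = n \<and> set x \<subseteq> alphabet (2 * m + 1) \<and> polarity_balanced x}"
    with le[of x] show "x \<in> (\<Union>j\<in>{0..n div 2}. ?S j)"
      by (auto simp: polarity_balanced_def length_filter_conv_card)
  qed (auto simp: polarity_balanced_def length_filter_conv_card)
  then have "M_PB n (2 * m + 1) = card (\<Union>j\<in>{0..n div 2}. ?S j)" by (simp add: M_PB_def)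
  also have "\<dots> = (\<Sum>j = 0..n div 2. card (?S j))"
    by (rule card_UN_disjoint) (use fin in auto)
  also have "\<dots> = (\<Sum>j = 0..n div 2. (n choose j) * ((n - j) choose j) * m ^ (2 * j))"
    by (intro sum.cong refl, subst card_lists_two_counts)
       (simp_all only: alphabet_sign_classes, auto simp: mult_2 power_add)
  finally show ?thesis .
qed

lemma real_M_PB_odd:
  "real (M_PB n (2 * m + 1)) =
     (\<Sum>j = 0..n div 2. fact n / (fact j * fact j * fact (n - 2 * j)) * real m ^ (2 * j))"
  unfolding M_PB_odd of_nat_sum
proof (intro sum.cong refl)
  fix j assume "j \<in> {0..n div 2}"
  \<comment> \<open>These inequalities let both binomials be written with factorials, whose common
    \<open>fact (n - j)\<close> cancels.\<close>
  then have "j \<le> n" "j \<le> n - j" "n - j - j = n - 2 * j" by auto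
  then show "real ((n choose j) * ((n - j) choose j) * m ^ (2 * j))
      = fact n / (fact j * fact j * fact (n - 2 * j)) * real m ^ (2 * j)"
    by (simp add: binomial_fact)
qed

theorem theorem7:
  fixes q :: nat
  assumes "q \<ge> 3" and "odd q"
  shows "(\<forall>n::nat. n > 0 \<longrightarrow>
            real (M_PB n q) =
              (\<Sum>j = 0..n div 2. fact n / (fact j * fact j * fact (n - 2 * j))
                 * ((real q - 1) / 2) ^ (2 * j)))
       \<and> (\<lambda>n. real (M_PB n q) /
                (real q ^ n * sqrt (real q / (2 * pi * real n * (real q - 1)))))
           \<longlonglongrightarrow> 1"
proof -
  obtain m where q: "q = 2 * m + 1" using assms(2) by (rule oddE)
  then have m: "real m > 0" "(real q - 1) / 2 = real m" "real q = 1 + 2 * real m"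
    "real q - 1 = 2 * real m"
    using assms(1) by auto
  have "real (M_PB n q) = (\<Sum>j = 0..n div 2. fact n / (fact j * fact j * fact (n - 2 * j))
                 * real m ^ (2 * j))" for n
    unfolding q by (rule real_M_PB_odd)
  \<comment> \<open>Substituting \<open>q - 1 = 2 * m\<close> matches the radicand with that of the
    trinomial asymptotics.\<close>
  moreover have "2 * pi * real n * (2 * real m) = 4 * pi * real n * real m" for n by simp
  ultimately show ?thesis
    using central_trinomial_sum_asymptotics[OF m(1)] unfolding m(2,4) m(3) by (simp add: mult.assoc)
qed

end
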